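(* Let $V=\mathbb{C}^4$ with linear coordinates $x_1,x_2,x_3,x_4$ and symplectic form $\omega=dx_1\wedge dx_2+dx_3\wedge dx_4$, so that $\mathbb{C}[V]=\mathbb{C}[x_1,x_2,x_3,x_4]$ carries the Poisson bracket $$\{\phi,\psi\}=\frac{\partial\phi}{\partial x_1}\frac{\partial\psi}{\partial x_2}-\frac{\partial\phi}{\partial x_2}\frac{\partial\psi}{\partial x_1}+\frac{\partial\phi}{\partial x_3}\frac{\partial\psi}{\partial x_4}-\frac{\partial\phi}{\partial x_4}\frac{\partial\psi}{\partial x_3}.$$ Let $G=\mathbb{Z}_2\ltimes(\mathbb{Z}_2\oplus\mathbb{Z}_2)$, with $e,b,c$ the generators of the three copies of $\mathbb{Z}_2$ (in that order), act on $V$ as follows: $b$ and $c$ act as $\mathrm{diag}(-1,-1,1,1)$ and $\mathrm{diag}(1,1,-1,-1)$, respectively, on $(x_1,x_2,x_3,x_4)$, and $e$ interchanges $x_1\leftrightarrow x_3$ and $x_2\leftrightarrow x_4$. Let $A=\mathbb{C}[V]\#G$. Then the Poisson bracket on $\mathbb{C}[V]^G$ cannot be extended to a noncommutative Poisson structure on $A$; that is, there is no noncommutative Poisson structure $\langle-,-\rangle$ on $A$ such that $\langle\overline{\phi},\overline{\psi}\rangle=\overline{\{\phi,\psi\}}$ for all $\phi,\psi\in\mathbb{C}[V]^G$.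
   Context: The group $G$ acts on $\mathbb{C}[V]$ by algebra automorphisms, written ${}^g\psi$ for $g\in G$, $\psi\in\mathbb{C}[V]$, and $\mathbb{C}[V]^G$ is the algebra of invariants; it is closed under $\{-,-\}$ since $G$ preserves $\omega$. The twisted group algebra $A=\mathbb{C}[V]\#G$ is the free left $\mathbb{C}[V]$-module with basis $G$ and multiplication $(\psi g)(\phi h)=\psi\,({}^g\phi)\,gh$ for $\psi,\phi\in\mathbb{C}[V]$, $g,h\in G$; $\mathbb{C}[V]$ is a subalgebra of $A$ via $\psi\mapsto\psi\cdot1$. For an associative algebra $A$ over $\mathbb{C}$, $[A,A]$ denotes the linear span of all commutators $ab-ba$ (not the ideal they generate), and $a\mapsto\overline{a}$ is the projection $A\to A/[A,A]$. For $A=\mathbb{C}[V]\#G$, the restriction of this projection to $\mathbb{C}[V]^G$ is injective, so $\mathbb{C}[V]^G$ is regarded as a subspace of $A/[A,A]$. A noncommutative Poisson structure (Crawley-Boevey) on an associative $\mathbb{C}$-algebra $A$ is a ($\mathbb{C}$-bilinear) Lie bracket $\langle-,-\rangle$ on the vector space $A/[A,A]$ such that for each $a\in A$ the map $\langle\overline{a},-\rangle:A/[A,A]\to A/[A,A]$ is induced by a ($\mathbb{C}$-linear) derivation $d_a:A\to A$, i.e. $\langle\overline{a},\overline{b}\rangle=\overline{d_a(b)}$ for all $b\in A$. *)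

theory Defs
  imports "HOL-Analysis.Analysis" "HOL-Library.Poly_Mapping" "HOL-Library.Z2"
begin

section \<open>Complex algebras\<close>

class scaleC =
  fixes scaleC :: "complex \<Rightarrow> 'a \<Rightarrow> 'a"  (infixr \<open>*\<^sub>C\<close> 75)

class complex_vector = scaleC + ab_group_add +
  assumes scaleC_add_right: "c *\<^sub>C (x + y) = c *\<^sub>C x + c *\<^sub>C y"
    and scaleC_add_left: "(c + d) *\<^sub>C x = c *\<^sub>C x + d *\<^sub>C x"
    and scaleC_scaleC: "c *\<^sub>C (d *\<^sub>C x) = (c * d) *\<^sub>C x"
    and scaleC_one: "1 *\<^sub>C x = x"

class complex_algebra = complex_vector + ring +
  assumes mult_scaleC_left: "(c *\<^sub>C x) * y = c *\<^sub>C (x * y)"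
    and mult_scaleC_right: "x * (c *\<^sub>C y) = c *\<^sub>C (x * y)"

global_interpretation complex_vec: vector_space "scaleC :: complex \<Rightarrow> 'a \<Rightarrow> 'a::complex_vector"
  by unfold_locales (simp_all add: scaleC_add_right scaleC_add_left scaleC_scaleC scaleC_one)

definition commutator_space :: "'a::complex_algebra set" where
  "commutator_space = complex_vec.span {a * b - b * a | a b. True}"

definition commutator_equiv :: "'a::complex_algebra \<Rightarrow> 'a \<Rightarrow> bool" where
  "commutator_equiv a b \<longleftrightarrow> a - b \<in> commutator_space"

lemma subspace_commutator_space: "complex_vec.subspace commutator_space"
  unfolding commutator_space_def by (rule complex_vec.subspace_span)

lemma equivp_commutator_equiv: "equivp commutator_equiv"
proof (rule equivpI)
  note sub = subspace_commutator_space
  show "reflp commutator_equiv"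
    using complex_vec.subspace_0[OF sub] by (simp add: reflp_def commutator_equiv_def)
  show "symp commutator_equiv"
    using complex_vec.subspace_neg[OF sub] by (fastforce simp: symp_def commutator_equiv_def)
  show "transp commutator_equiv"
    using complex_vec.subspace_add[OF sub] by (fastforce simp: transp_def commutator_equiv_def)
qed

text \<open>The quotient vector space \<open>A/[A,A]\<close>, with projection \<open>proj\<close>.\<close>

quotient_type (overloaded) 'a comm_quotient = "'a::complex_algebra" / commutator_equiv
  morphisms rep_comm_quotient proj
  by (rule equivp_commutator_equiv)

instantiation comm_quotient :: (complex_algebra) complex_vector
begin

lift_definition zero_comm_quotient :: "'a comm_quotient" is 0 .

lift_definition plus_comm_quotient :: "'a comm_quotient \<Rightarrow> 'a comm_quotient \<Rightarrow> 'a comm_quotient"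
  is "(+)"
  unfolding commutator_equiv_def
  using complex_vec.subspace_add[OF subspace_commutator_space] by (metis add_diff_add)

lift_definition uminus_comm_quotient :: "'a comm_quotient \<Rightarrow> 'a comm_quotient" is uminus
  unfolding commutator_equiv_def
  using complex_vec.subspace_neg[OF subspace_commutator_space]
  by (metis minus_diff_eq minus_diff_minus)

lift_definition minus_comm_quotient :: "'a comm_quotient \<Rightarrow> 'a comm_quotient \<Rightarrow> 'a comm_quotient"
  is "(-)"
  unfolding commutator_equiv_def
  by (drule (1) complex_vec.subspace_diff[OF subspace_commutator_space])
    (simp add: algebra_simps)

lift_definition scaleC_comm_quotient :: "complex \<Rightarrow> 'a comm_quotient \<Rightarrow> 'a comm_quotient"
  is scaleC
  unfolding commutator_equiv_def
  by (metis complex_vec.subspace_scale[OF subspace_commutator_space]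
      complex_vec.scale_right_diff_distrib)

instance
proof -
  have refl: "commutator_equiv x x" for x :: 'a
    using equivp_commutator_equiv by (rule equivp_reflp)
  show "OFCLASS('a comm_quotient, complex_vector_class)"
    by intro_classes
      (transfer; simp add: refl algebra_simps scaleC_add_right scaleC_add_left scaleC_scaleC scaleC_one)+
qed

end

lemma proj_eq_iff: "proj a = proj b \<longleftrightarrow> a - b \<in> commutator_space"
  by (simp add: comm_quotient.abs_eq_iff commutator_equiv_def)

lemma proj_add: "proj (a + b) = proj a + proj b"
  by (simp add: plus_comm_quotient.abs_eq)

lemma proj_scaleC: "proj (c *\<^sub>C a) = c *\<^sub>C proj a"
  by (simp add: scaleC_comm_quotient.abs_eq)


section \<open>Noncommutative Poisson structures\<close>

definition derivation :: "('a::complex_algebra \<Rightarrow> 'a) \<Rightarrow> bool" where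
  "derivation d \<longleftrightarrow> Vector_Spaces.linear scaleC scaleC d \<and> (\<forall>a b. d (a * b) = d a * b + a * d b)"

definition lie_bracket :: "('v::complex_vector \<Rightarrow> 'v \<Rightarrow> 'v) \<Rightarrow> bool" where
  "lie_bracket br \<longleftrightarrow>
     (\<forall>u. Vector_Spaces.linear scaleC scaleC (\<lambda>v. br u v)) \<and>
     (\<forall>v. Vector_Spaces.linear scaleC scaleC (\<lambda>u. br u v)) \<and>
     (\<forall>u. br u u = 0) \<and>
     (\<forall>u v w. br u (br v w) + br v (br w u) + br w (br u v) = 0)"

definition nc_poisson_structure ::
    "('a::complex_algebra comm_quotient \<Rightarrow> 'a comm_quotient \<Rightarrow> 'a comm_quotient) \<Rightarrow> bool" where
  "nc_poisson_structure br \<longleftrightarrow>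
     lie_bracket br \<and> (\<forall>a. \<exists>d. derivation d \<and> (\<forall>b. br (proj a) (proj b) = proj (d b)))"


section \<open>Polynomials in four variables\<close>

text \<open>
  A polynomial maps exponent vectors to coefficients; multiplication is convolution.
  The numerals \<open>1, 2, 3, 4\<close> are the four distinct elements of the index type \<open>4\<close> (where \<open>4 = 0\<close>).
\<close>

type_synonym cpoly = "(4 \<Rightarrow>\<^sub>0 nat) \<Rightarrow>\<^sub>0 complex"

abbreviation Const :: "complex \<Rightarrow> cpoly" where
  "Const c \<equiv> Poly_Mapping.single 0 c"

definition Var :: "4 \<Rightarrow> cpoly" where
  "Var i = Poly_Mapping.single (Poly_Mapping.single i 1) 1"

text \<open>The truncated subtraction of exponents is harmless: if \<open>m i = 0\<close> the coefficient vanishes.\<close>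

definition pdiff :: "4 \<Rightarrow> cpoly \<Rightarrow> cpoly" where
  "pdiff i p = (\<Sum>m\<in>Poly_Mapping.keys p.
     Poly_Mapping.single (m - Poly_Mapping.single i 1)
       (of_nat (Poly_Mapping.lookup m i) * Poly_Mapping.lookup p m))"

lemma pdiff_single:
  "pdiff i (Poly_Mapping.single m c) =
     Poly_Mapping.single (m - Poly_Mapping.single i 1) (of_nat (Poly_Mapping.lookup m i) * c)"
  by (simp add: pdiff_def)

definition poisson :: "cpoly \<Rightarrow> cpoly \<Rightarrow> cpoly" where
  "poisson p q =
     pdiff 1 p * pdiff 2 q - pdiff 2 p * pdiff 1 q + pdiff 3 p * pdiff 4 q - pdiff 4 p * pdiff 3 q"

definition monom_subst :: "(4 \<Rightarrow> cpoly) \<Rightarrow> (4 \<Rightarrow>\<^sub>0 nat) \<Rightarrow> cpoly" where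
  "monom_subst s m = (\<Prod>i\<in>UNIV. s i ^ Poly_Mapping.lookup m i)"

definition poly_subst :: "(4 \<Rightarrow> cpoly) \<Rightarrow> cpoly \<Rightarrow> cpoly" where
  "poly_subst s p = (\<Sum>m\<in>Poly_Mapping.keys p. Const (Poly_Mapping.lookup p m) * monom_subst s m)"

lemma poly_subst_0 [simp]: "poly_subst s 0 = 0"
  by (simp add: poly_subst_def)

lemma poly_subst_add: "poly_subst s (p + q) = poly_subst s p + poly_subst s q"
  unfolding poly_subst_def
  by (rule setsum_keys_plus_distrib) (simp_all add: single_add distrib_right)

lemma poly_subst_sum: "poly_subst s (sum f A) = (\<Sum>i\<in>A. poly_subst s (f i))"
  by (induction A rule: infinite_finite_induct) (simp_all add: poly_subst_add)

lemma poly_subst_single: "poly_subst s (Poly_Mapping.single m c) = Const c * monom_subst s m"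
  by (simp add: poly_subst_def)

lemma monom_subst_add: "monom_subst s (m + n) = monom_subst s m * monom_subst s n"
  by (simp add: monom_subst_def lookup_add power_add prod.distrib)

lemma poly_expansion:
  fixes p :: "'b \<Rightarrow>\<^sub>0 'c::comm_monoid_add"
  shows "p = (\<Sum>m\<in>Poly_Mapping.keys p. Poly_Mapping.single m (Poly_Mapping.lookup p m))"
  by (rule poly_mapping_eqI)
    (simp add: lookup_sum lookup_single when_def sum.delta in_keys_iff)

lemma Const_mult: "Const (a * b) = Const a * Const b"
  by (simp add: mult_single)

lemma poly_subst_mult: "poly_subst s (p * q) = poly_subst s p * poly_subst s q"
proof -
  have "poly_subst s (Poly_Mapping.single m c * Poly_Mapping.single n d) =
      poly_subst s (Poly_Mapping.single m c) * poly_subst s (Poly_Mapping.single n d)" for m n c d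
    by (simp only: mult_single poly_subst_single monom_subst_add Const_mult ac_simps)
  then have "poly_subst s ((\<Sum>m\<in>A. Poly_Mapping.single m (f m)) * (\<Sum>n\<in>B. Poly_Mapping.single n (g n))) =
      poly_subst s (\<Sum>m\<in>A. Poly_Mapping.single m (f m)) *
      poly_subst s (\<Sum>n\<in>B. Poly_Mapping.single n (g n))" for A B f g
    by (simp only: sum_product poly_subst_sum)
  from this[of "Poly_Mapping.lookup p" "Poly_Mapping.keys p" "Poly_Mapping.lookup q" "Poly_Mapping.keys q"]
  show ?thesis by (simp only: poly_expansion[symmetric])
qed

lemma monom_subst_0 [simp]: "monom_subst s 0 = 1"
  by (simp add: monom_subst_def)

lemma poly_subst_Const [simp]: "poly_subst s (Const c) = Const c"
  by (simp add: poly_subst_single)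

lemma poly_subst_1 [simp]: "poly_subst s 1 = 1"
  using poly_subst_Const[of s 1] by simp

lemma poly_subst_Var [simp]: "poly_subst s (Var i) = s i"
proof -
  have "monom_subst s (Poly_Mapping.single i 1) = (\<Prod>j\<in>UNIV. if j = i then s i else 1)"
    unfolding monom_subst_def by (rule prod.cong) (auto simp: lookup_single when_def)
  then show ?thesis by (simp add: Var_def poly_subst_single)
qed

lemma poly_subst_power: "poly_subst s (p ^ n) = poly_subst s p ^ n"
  by (induction n) (simp_all add: poly_subst_mult)

lemma poly_subst_prod: "poly_subst s (prod f A) = (\<Prod>i\<in>A. poly_subst s (f i))"
  by (induction A rule: infinite_finite_induct) (simp_all add: poly_subst_mult)

lemma poly_subst_subst: "poly_subst s (poly_subst t p) = poly_subst (\<lambda>i. poly_subst s (t i)) p"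
  by (simp add: poly_subst_def[of t] poly_subst_def[of "\<lambda>i. poly_subst s (t i)"]
      poly_subst_sum poly_subst_mult monom_subst_def poly_subst_prod poly_subst_power)

lemma monom_subst_Var: "monom_subst Var m = Poly_Mapping.single m 1"
proof -
  have pow: "Var i ^ k = Poly_Mapping.single (Poly_Mapping.single i k) 1" for i k
    by (induction k) (simp_all add: Var_def mult_single flip: single_add)
  have "(\<Prod>i\<in>A. Poly_Mapping.single (f i) 1) = (Poly_Mapping.single (sum f A) 1 :: cpoly)"
    if "finite A" for A and f :: "4 \<Rightarrow> 4 \<Rightarrow>\<^sub>0 nat"
    using that by induction (simp_all add: mult_single)
  moreover have "(\<Sum>i\<in>UNIV. Poly_Mapping.single i (Poly_Mapping.lookup m i)) = m"
    by (rule poly_mapping_eqI) (simp add: lookup_sum lookup_single when_def)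
  ultimately show ?thesis by (simp add: monom_subst_def pow)
qed

lemma poly_subst_id [simp]: "poly_subst Var p = p"
  by (simp add: poly_subst_def monom_subst_Var mult_single flip: poly_expansion)

text \<open>\<open>pullback M p\<close> is the polynomial \<open>v \<mapsto> p (M v)\<close>.\<close>

definition pullback :: "complex ^ 4 ^ 4 \<Rightarrow> cpoly \<Rightarrow> cpoly" where
  "pullback M p = poly_subst (\<lambda>i. \<Sum>j\<in>UNIV. Const (M $ i $ j) * Var j) p"

lemma Const_sum: "Const (sum f A) = (\<Sum>i\<in>A. Const (f i))"
  by (induction A rule: infinite_finite_induct) (simp_all add: single_add)

lemma pullback_mult_matrix: "pullback (M ** N) p = pullback N (pullback M p)"
proof -
  have "(\<Sum>j\<in>UNIV. Const ((M ** N) $ i $ j) * Var j) =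
      poly_subst (\<lambda>i. \<Sum>j\<in>UNIV. Const (N $ i $ j) * Var j) (\<Sum>j\<in>UNIV. Const (M $ i $ j) * Var j)" for i
  proof -
    have "(\<Sum>j\<in>UNIV. Const ((M ** N) $ i $ j) * Var j) =
        (\<Sum>j\<in>UNIV. \<Sum>k\<in>UNIV. Const (M $ i $ k) * (Const (N $ k $ j) * Var j))"
      by (simp only: matrix_matrix_mult_def vec_lambda_beta Const_sum Const_mult sum_distrib_right mult.assoc)
    also have "\<dots> = (\<Sum>k\<in>UNIV. \<Sum>j\<in>UNIV. Const (M $ i $ k) * (Const (N $ k $ j) * Var j))"
      by (rule sum.swap)
    also have "\<dots> = (\<Sum>k\<in>UNIV. Const (M $ i $ k) * (\<Sum>j\<in>UNIV. Const (N $ k $ j) * Var j))"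
      by (simp only: sum_distrib_left)
    finally show ?thesis
      by (simp only: poly_subst_sum poly_subst_mult poly_subst_Const poly_subst_Var)
  qed
  then show ?thesis
    unfolding pullback_def by (simp add: poly_subst_subst)
qed

lemma pullback_mat_1: "pullback (mat 1) p = p"
proof -
  have "(\<lambda>i. \<Sum>j\<in>UNIV. Const (mat 1 $ i $ j) * Var j) = Var"
  proof
    fix i :: 4
    have "(\<Sum>j\<in>UNIV. Const (mat 1 $ i $ j) * Var j) = (\<Sum>j\<in>UNIV. if i = j then Var j else 0)"
      by (rule sum.cong) (auto simp: mat_def)
    then show "(\<Sum>j\<in>UNIV. Const (mat 1 $ i $ j) * Var j) = Var i" by simp
  qed
  then show ?thesis by (simp add: pullback_def)
qed


section \<open>The group and its action\<close>

text \<open>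
  \<open>Elt i j k\<close> is \<open>e\<^sup>i b\<^sup>j c\<^sup>k\<close>; the factor generated by \<open>e\<close> acts on the other two by exchanging
  \<open>b\<close> and \<open>c\<close>, as the matrices below force.
\<close>

datatype grp = Elt bit bit bit

instantiation grp :: "{monoid_mult, inverse}"
begin

definition one_grp :: grp where
  "1 = Elt 0 0 0"

fun times_grp :: "grp \<Rightarrow> grp \<Rightarrow> grp" where
  "Elt i j k * Elt i' j' k' =
     (if i' = 0 then Elt (i + i') (j + j') (k + k') else Elt (i + i') (k + j') (j + k'))"

fun inverse_grp :: "grp \<Rightarrow> grp" where
  "inverse (Elt i j k) = (if i = 0 then Elt i j k else Elt i k j)"

definition divide_grp :: "grp \<Rightarrow> grp \<Rightarrow> grp" where
  "divide_grp g h = g * inverse h"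

instance
proof
  fix f g h :: grp
  show "f * g * h = f * (g * h)"
    by (cases f; cases g; cases h) (auto simp: ac_simps simp del: add_bit_eq_xor)
  show "1 * g = g" "g * 1 = g"
    by (cases g; simp add: one_grp_def)+
qed

end

lemma grp_inverse [simp]: "inverse g * g = 1" "g * inverse g = (1::grp)"
  by (cases g; auto simp: one_grp_def)+

lemma grp_inverse_cancel [simp]: "inverse g * (g * h) = h" "g * (inverse g * h) = (h::grp)"
  by (simp_all flip: mult.assoc)

lemma grp_inverse_1 [simp]: "inverse (1::grp) = 1"
  by (simp add: one_grp_def)

lemma grp_inverse_mult_eq_iff: "inverse g * k = h \<longleftrightarrow> k = g * (h::grp)"
  by (metis grp_inverse_cancel)

lemma grp_inverse_mult: "inverse (g * h) = inverse h * inverse (g::grp)"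
  using grp_inverse_mult_eq_iff[of "g * h" 1 "inverse h * inverse g"] by (simp add: mult.assoc)

instance grp :: finite
proof
  have bit: "i \<in> {0, 1}" for i :: bit
    by (cases i) auto
  have "UNIV \<subseteq> (\<lambda>(i, j, k). Elt i j k) ` ({0, 1} \<times> {0, 1} \<times> {0, 1})"
  proof
    fix g :: grp
    obtain i j k where "g = Elt i j k" by (cases g)
    then show "g \<in> (\<lambda>(i, j, k). Elt i j k) ` ({0, 1} \<times> {0, 1} \<times> {0, 1})"
      using bit[of i] bit[of j] bit[of k] by (intro image_eqI[of _ _ "(i, j, k)"] SigmaI) simp_all
  qed
  then show "finite (UNIV :: grp set)" by (rule finite_subset) simp
qed

definition gen_e :: grp where "gen_e = Elt 1 0 0"
definition gen_b :: grp where "gen_b = Elt 0 1 0"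
definition gen_c :: grp where "gen_c = Elt 0 0 1"

lemma grp_relations:
  "gen_e * gen_e = 1" "gen_b * gen_b = 1" "gen_c * gen_c = 1"
  "gen_b * gen_c = gen_c * gen_b" "gen_e * gen_b * gen_e = gen_c"
  by (simp_all add: gen_e_def gen_b_def gen_c_def one_grp_def)

definition mat_e :: "complex ^ 4 ^ 4" where
  "mat_e = vector [vector [0, 0, 1, 0], vector [0, 0, 0, 1], vector [1, 0, 0, 0], vector [0, 1, 0, 0]]"

definition mat_b :: "complex ^ 4 ^ 4" where
  "mat_b = vector [vector [-1, 0, 0, 0], vector [0, -1, 0, 0], vector [0, 0, 1, 0], vector [0, 0, 0, 1]]"

definition mat_c :: "complex ^ 4 ^ 4" where
  "mat_c = vector [vector [1, 0, 0, 0], vector [0, 1, 0, 0], vector [0, 0, -1, 0], vector [0, 0, 0, -1]]"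

fun gmat :: "grp \<Rightarrow> complex ^ 4 ^ 4" where
  "gmat (Elt i j k) =
     (if i = 0 then mat 1 else mat_e) ** (if j = 0 then mat 1 else mat_b) ** (if k = 0 then mat 1 else mat_c)"

lemma vector_4:
  "(vector [w, x, y, z] :: 'a::zero ^ 4) $ 1 = w" "(vector [w, x, y, z] :: 'a ^ 4) $ 2 = x"
  "(vector [w, x, y, z] :: 'a ^ 4) $ 3 = y" "(vector [w, x, y, z] :: 'a ^ 4) $ 4 = z"
  by (simp_all add: vector_def)

lemma mat_relations:
  "mat_e ** mat_e = mat 1" "mat_b ** mat_b = mat 1" "mat_c ** mat_c = mat 1"
  "mat_c ** mat_b = mat_b ** mat_c" "mat_b ** mat_e = mat_e ** mat_c" "mat_c ** mat_e = mat_e ** mat_b"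
  by (simp_all add: vec_eq_iff forall_4 matrix_matrix_mult_def sum_4 mat_def mat_e_def mat_b_def mat_c_def
      vector_4)

lemma gmat_1: "gmat 1 = mat 1"
  by (simp add: one_grp_def)

lemma gmat_mult: "gmat (g * h) = gmat g ** gmat h"
proof -
  note rel = mat_relations
  have rel': "mat_e ** (mat_e ** M) = M" "mat_b ** (mat_b ** M) = M" "mat_c ** (mat_c ** M) = M"
    "mat_c ** (mat_b ** M) = mat_b ** (mat_c ** M)" "mat_b ** (mat_e ** M) = mat_e ** (mat_c ** M)"
    "mat_c ** (mat_e ** M) = mat_e ** (mat_b ** M)" for M
    by (metis matrix_mul_assoc matrix_mul_lid rel)+
  show ?thesis
    by (cases g; cases h) (auto simp: rel rel' simp flip: matrix_mul_assoc)
qed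

text \<open>The action on functions: \<open>(g \<psi>)(v) = \<psi> (g\<^sup>-\<^sup>1 v)\<close>.\<close>

definition act :: "grp \<Rightarrow> cpoly \<Rightarrow> cpoly" where
  "act g p = pullback (gmat (inverse g)) p"

lemma act_add: "act g (p + q) = act g p + act g q"
  by (simp add: act_def pullback_def poly_subst_add)

lemma act_mult: "act g (p * q) = act g p * act g q"
  by (simp add: act_def pullback_def poly_subst_mult)

lemma act_0 [simp]: "act g 0 = 0"
  by (simp add: act_def pullback_def)

lemma act_Const [simp]: "act g (Const c) = Const c"
  by (simp add: act_def pullback_def)

lemma act_sum: "act g (sum f A) = (\<Sum>i\<in>A. act g (f i))"
  by (simp add: act_def pullback_def poly_subst_sum)

lemma act_1 [simp]: "act 1 p = p"
  by (simp add: act_def one_grp_def pullback_mat_1)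

lemma act_act: "act g (act h p) = act (g * h) p"
  by (simp add: act_def grp_inverse_mult gmat_mult pullback_mult_matrix)

lemma act_generators:
  "act gen_e (Var 1) = Var 3" "act gen_e (Var 2) = Var 4"
  "act gen_e (Var 3) = Var 1" "act gen_e (Var 4) = Var 2"
  "act gen_b (Var 1) = - Var 1" "act gen_b (Var 2) = - Var 2"
  "act gen_b (Var 3) = Var 3" "act gen_b (Var 4) = Var 4"
  "act gen_c (Var 1) = Var 1" "act gen_c (Var 2) = Var 2"
  "act gen_c (Var 3) = - Var 3" "act gen_c (Var 4) = - Var 4"
  by (simp_all add: act_def pullback_def gen_e_def gen_b_def gen_c_def sum_4 mat_e_def mat_b_def mat_c_def
      vector_4 single_uminus)

definition invariants :: "cpoly set" where
  "invariants = {p. \<forall>g. act g p = p}"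


section \<open>The twisted group algebra\<close>

text \<open>An element \<open>\<Sum>\<^sub>g \<psi>\<^sub>g g\<close> is given by its coefficient family \<open>g \<mapsto> \<psi>\<^sub>g\<close>.\<close>

typedef twisted = "UNIV :: (grp \<Rightarrow> cpoly) set"
  morphisms coeff_at Twisted
  by simp

setup_lifting type_definition_twisted

instantiation twisted :: "{complex_algebra, ring_1}"
begin

lift_definition zero_twisted :: twisted is "\<lambda>g. 0" .

lift_definition one_twisted :: twisted is "\<lambda>g. if g = 1 then 1 else 0" .

lift_definition plus_twisted :: "twisted \<Rightarrow> twisted \<Rightarrow> twisted" is "\<lambda>a b g. a g + b g" .

lift_definition uminus_twisted :: "twisted \<Rightarrow> twisted" is "\<lambda>a g. - a g" .

lift_definition minus_twisted :: "twisted \<Rightarrow> twisted \<Rightarrow> twisted" is "\<lambda>a b g. a g - b g" .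

lift_definition scaleC_twisted :: "complex \<Rightarrow> twisted \<Rightarrow> twisted" is "\<lambda>c a g. Const c * a g" .

lift_definition times_twisted :: "twisted \<Rightarrow> twisted \<Rightarrow> twisted" is
  "\<lambda>a b k. \<Sum>(g, h) | g * h = k. a g * act g (b h)" .

lemma twisted_mult_sum:
  fixes F :: "grp \<Rightarrow> grp \<Rightarrow> cpoly"
  shows "(\<Sum>(g, h) | g * h = k. F g h) = (\<Sum>g\<in>UNIV. F g (inverse g * k))"
  by (rule sum.reindex_bij_witness[of _ "\<lambda>g. (g, inverse g * k)" fst])
    auto

instance
proof
  fix a b c :: twisted and r s :: complex
  show "a * b * c = a * (b * c)"
  proof (transfer, unfold twisted_mult_sum, rule ext)
    fix a b c :: "grp \<Rightarrow> cpoly" and k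
    have "(\<Sum>g\<in>UNIV. (\<Sum>f\<in>UNIV. a f * act f (b (inverse f * g))) * act g (c (inverse g * k))) =
        (\<Sum>f\<in>UNIV. \<Sum>g\<in>UNIV. a f * act f (b (inverse f * g)) * act g (c (inverse g * k)))"
      by (subst sum.swap) (simp add: sum_distrib_right)
    also have "\<dots> = (\<Sum>f\<in>UNIV. \<Sum>h\<in>UNIV. a f * act f (b h) * act (f * h) (c (inverse h * (inverse f * k))))"
    proof (rule sum.cong[OF refl])
      fix f :: grp
      show "(\<Sum>g\<in>UNIV. a f * act f (b (inverse f * g)) * act g (c (inverse g * k))) =
          (\<Sum>h\<in>UNIV. a f * act f (b h) * act (f * h) (c (inverse h * (inverse f * k))))"
        by (rule sum.reindex_bij_witness[of _ "\<lambda>h. f * h" "\<lambda>g. inverse f * g"])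
          (simp_all add: grp_inverse_mult mult.assoc)
    qed
    also have "\<dots> = (\<Sum>f\<in>UNIV. a f * act f (\<Sum>h\<in>UNIV. b h * act h (c (inverse h * (inverse f * k)))))"
      by (simp add: act_sum act_mult act_act sum_distrib_left mult.assoc)
    finally show "(\<Sum>g\<in>UNIV. (\<Sum>f\<in>UNIV. a f * act f (b (inverse f * g))) * act g (c (inverse g * k))) =
        (\<Sum>f\<in>UNIV. a f * act f (\<Sum>h\<in>UNIV. b h * act h (c (inverse h * (inverse f * k)))))" .
  qed
  show "(a + b) * c = a * c + b * c"
    by transfer (simp add: twisted_mult_sum distrib_right sum.distrib)
  show "a * (b + c) = a * b + a * c"
    by transfer (simp add: twisted_mult_sum act_add distrib_left sum.distrib)
  show "r *\<^sub>C a * b = r *\<^sub>C (a * b)"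
    by transfer (simp add: twisted_mult_sum sum_distrib_left mult.assoc)
  show "a * r *\<^sub>C b = r *\<^sub>C (a * b)"
    by transfer (simp add: twisted_mult_sum act_mult sum_distrib_left mult.left_commute)
  show "1 * a = a"
  proof (transfer, unfold twisted_mult_sum, rule ext)
    fix a :: "grp \<Rightarrow> cpoly" and k
    have "(\<Sum>g\<in>UNIV. (if g = 1 then 1 else 0) * act g (a (inverse g * k))) =
        (\<Sum>g\<in>(UNIV :: grp set). if g = 1 then a k else 0)"
      by (rule sum.cong) auto
    then show "(\<Sum>g\<in>UNIV. (if g = 1 then 1 else 0) * act g (a (inverse g * k))) = a k" by simp
  qed
  show "a * 1 = a"
  proof (transfer, unfold twisted_mult_sum, rule ext)
    fix a :: "grp \<Rightarrow> cpoly" and k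
    have act_one: "act g 1 = 1" for g using act_Const[of g 1] by simp
    have "(\<Sum>g\<in>UNIV. a g * act g (if inverse g * k = 1 then 1 else 0)) =
        (\<Sum>g\<in>UNIV. if g = k then a k else 0)"
      by (rule sum.cong) (auto simp: act_one grp_inverse_mult_eq_iff)
    then show "(\<Sum>g\<in>UNIV. a g * act g (if inverse g * k = 1 then 1 else 0)) = a k" by simp
  qed
  show "(0::twisted) \<noteq> 1" by transfer (auto simp: fun_eq_iff)
qed (transfer; auto simp: algebra_simps single_add mult_single fun_eq_iff)+

end

definition basis_elt :: "cpoly \<Rightarrow> grp \<Rightarrow> twisted" where
  "basis_elt p g = Twisted (\<lambda>h. if h = g then p else 0)"

lemma basis_elt_mult: "basis_elt p g * basis_elt q h = basis_elt (p * act g q) (g * h)"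
proof -
  have "(\<Sum>f\<in>UNIV. (if f = g then p else 0) * act f (if inverse f * k = h then q else 0)) =
      (if k = g * h then p * act g q else 0)" for k
  proof -
    have "(\<Sum>f\<in>UNIV. (if f = g then p else 0) * act f (if inverse f * k = h then q else 0)) =
        (\<Sum>f\<in>UNIV. if f = g then (if k = g * h then p * act g q else 0) else 0)"
      by (rule sum.cong) (auto simp: grp_inverse_mult_eq_iff)
    then show ?thesis by simp
  qed
  then show ?thesis
    unfolding basis_elt_def
    by (simp add: times_twisted.abs_eq twisted_mult_sum)
qed

definition embed_poly :: "cpoly \<Rightarrow> twisted" where
  "embed_poly p = basis_elt p 1"

end

theory Submission
  imports Defs
begin

text \<open>
  Let \<open>\<phi>, \<psi>\<close> be invariant polynomials. They are central in \<open>A\<close>, a derivation of \<open>A\<close> preserves the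
  centre, and the centre is \<open>\<complex>[V]\<^sup>G\<close> because \<open>G\<close> acts faithfully. So the derivation \<open>d\<close> inducing
  \<open>\<langle>\<phi>, -\<rangle>\<close> maps \<open>\<psi>\<close> to \<open>{\<phi>, \<psi>}\<close> on the nose. From \<open>b\<^sup>2 = 1\<close> one gets \<open>d b = - b (d b) b\<close>, so
  \<open>\<psi> d b\<close> vanishes in \<open>A/[A,A]\<close>, and \<open>\<langle>\<phi>, \<psi> b\<rangle>\<close> is the class of \<open>{\<phi>, \<psi>} b\<close>. By skew-symmetry
  it is also \<open>- \<langle>\<psi> b, \<phi>\<rangle>\<close>, the class of a central element, that is, of an element of \<open>\<complex>[V]\<^sup>G\<close>.
  Hence every trace supported on the conjugacy class of \<open>b\<close> kills \<open>{\<phi>, \<psi>} b\<close>. For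
  \<open>\<phi> = x\<^sub>1\<^sup>2 + x\<^sub>3\<^sup>2\<close> and \<open>\<psi> = x\<^sub>2\<^sup>2 + x\<^sub>4\<^sup>2\<close> this fails for the trace given by evaluation at the
  point \<open>(0, 0, 1, 1)\<close> fixed by \<open>b\<close>, since \<open>{\<phi>, \<psi>} = 4 (x\<^sub>1 x\<^sub>2 + x\<^sub>3 x\<^sub>4)\<close>.
\<close>

section \<open>Derivations and the centre\<close>

lemma derivation_mult: "derivation d \<Longrightarrow> d (a * b) = d a * b + a * d b"
  by (simp add: derivation_def)

lemma derivation_one:
  fixes d :: "'a::{complex_algebra, ring_1} \<Rightarrow> 'a"
  assumes "derivation d"
  shows "d 1 = 0"
  using derivation_mult[OF assms, of 1 1] by simp

text \<open>Apply \<open>d\<close> to \<open>z * a = a * z\<close>; the two terms containing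
  \<open>d a\<close> cancel because \<open>z\<close> is central.\<close>

lemma derivation_central:
  assumes d: "derivation d" and z: "\<And>a. z * a = a * z"
  shows "d z * a = a * d z"
proof -
  have "d z * a + z * d a = d a * z + a * d z"
    by (simp only: z[of a] flip: derivation_mult[OF d])
  then show ?thesis by (simp add: z)
qed

lemma commutator_in_commutator_space: "a * b - b * a \<in> commutator_space"
  unfolding commutator_space_def by (rule complex_vec.span_base) auto

lemma proj_mult_commute: "proj (a * b) = proj (b * a)"
  by (simp add: proj_eq_iff commutator_in_commutator_space)

lemma proj_0: "proj 0 = 0"
  using proj_scaleC[of 0 0] by simp

lemma complex_vector_double_eq_0:
  fixes v :: "'a::complex_vector"
  assumes "v + v = 0"
  shows "v = 0"
proof -
  have "2 *\<^sub>C v = 0"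
    using assms scaleC_add_left[of 1 1 v] by (simp add: scaleC_one)
  then show ?thesis by simp
qed

text \<open>\<open>z * d s\<close> is the negative of \<open>z * s * d s * s\<close>, yet rotating
  the last \<open>s\<close> to the front shows that both have the same class. So twice this class is
  zero.\<close>

lemma proj_derivation_involution:
  fixes z s :: "'a::{complex_algebra, ring_1}"
  assumes d: "derivation d" and z: "\<And>a. z * a = a * z" and s: "s * s = 1"
  shows "proj (z * d s) = 0"
proof -
  have *: "d s * s + s * d s = 0"
    using derivation_mult[OF d, of s s] by (simp add: s derivation_one[OF d])
  have "z * d s * s * s + z * s * d s * s = z * (d s * s + s * d s) * s"
    by (simp add: algebra_simps)
  then have "z * d s + z * s * d s * s = 0"
    using * by (simp add: mult.assoc s)
  then have "proj (z * d s) + proj (z * s * d s * s) = proj 0"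
    by (simp flip: proj_add)
  moreover have "proj (z * s * d s * s) = proj (s * (z * s * d s))"
    by (rule proj_mult_commute)
  moreover have "s * (z * s * d s) = z * d s"
    by (metis mult.assoc mult_1 s z)
  ultimately have "proj (z * d s) + proj (z * d s) = 0"
    by (simp add: proj_0)
  then show ?thesis by (rule complex_vector_double_eq_0)
qed

lemma lie_bracket_skew:
  assumes "lie_bracket br"
  shows "br u v = - br v u"
proof -
  interpret l: Vector_Spaces.linear scaleC scaleC "\<lambda>x. br w x" for w
    using assms by (simp add: lie_bracket_def)
  interpret r: Vector_Spaces.linear scaleC scaleC "\<lambda>x. br x w" for w
    using assms by (simp add: lie_bracket_def)
  have "br w w = 0" for w
    using assms by (simp add: lie_bracket_def)
  then have "br u v + br v u = 0"
    using l.add[of "u + v" u v] r.add[of u v u] r.add[of u v v] by (simp add: add.commute)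
  then show ?thesis by (simp add: eq_neg_iff_add_eq_0)
qed


section \<open>The action on polynomials\<close>

lemma bit_cases: "(i::bit) = 0 \<or> i = 1"
  by (cases i) auto

lemma grp_generated:
  assumes "P 1" "\<And>g. P g \<Longrightarrow> P (gen_e * g)" "\<And>g. P g \<Longrightarrow> P (gen_b * g)" "\<And>g. P g \<Longrightarrow> P (gen_c * g)"
  shows "P g"
proof -
  have P: "P 1" "P gen_c" "P gen_b" "P (gen_b * gen_c)"
    "P (gen_e * 1)" "P (gen_e * gen_c)" "P (gen_e * gen_b)" "P (gen_e * (gen_b * gen_c))"
    using assms(1) assms(2)[of 1] assms(3)[of 1] assms(4)[of 1] assms(3)[of gen_c]
      assms(2)[of gen_c] assms(2)[of gen_b] assms(2)[of "gen_b * gen_c"] by simp_all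
  obtain i j k where "g = Elt i j k" by (cases g)
  with P show ?thesis
    using bit_cases[of i] bit_cases[of j] bit_cases[of k]
    by (auto simp: gen_e_def gen_b_def gen_c_def one_grp_def)
qed

lemma grp_inverse_inverse: "inverse (inverse g) = (g::grp)"
  by (metis grp_inverse(1) grp_inverse_cancel(2) mult_1_right)

lemma invariantsI:
  assumes "act gen_e p = p" "act gen_b p = p" "act gen_c p = p"
  shows "p \<in> invariants"
proof -
  have "act g p = p" for g
    by (induction g rule: grp_generated) (simp_all add: assms flip: act_act)
  then show ?thesis by (simp add: invariants_def)
qed

lemma act_uminus: "act g (- p) = - act g p"
  using act_add[of g p "- p"] by (simp add: eq_neg_iff_add_eq_0 add.commute)

lemma act_one: "act g 1 = 1"
  using act_Const[of g 1] by simp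

text \<open>A single witness of faithfulness: the coefficients 1 and 2 differ even up to sign, so
  both the swap and the sign changes are detected.\<close>

lemma act_Var13_eq_imp:
  assumes "act g (Var 1 + Const 2 * Var 3) = Var 1 + Const 2 * Var 3"
  shows "g = 1"
proof -
  obtain i j k where g: "g = Elt i j k" by (cases g)
  \<comment> \<open>\<open>l i\<close> is the coefficient of the i-th coordinate, enough to compare
    linear forms.\<close>
  define l :: "4 \<Rightarrow> cpoly \<Rightarrow> complex" where "l i p = Poly_Mapping.lookup p (Poly_Mapping.single i 1)" for i p
  have "Poly_Mapping.single i (Suc 0) = Poly_Mapping.single j (Suc 0) \<longleftrightarrow> i = j" for i j :: 4
    by (metis lookup_single_eq lookup_single_not_eq nat.simps(3))
  then have l_add: "l i (p + q) = l i p + l i q" and l_minus: "l i (- p) = - l i p"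
    and l_Var: "l i (Var j) = (if i = j then 1 else 0)"
    and l_Const: "l i (Const c * Var j) = (if i = j then c else 0)" for i j p q c
    by (auto simp: l_def lookup_add Var_def lookup_single when_def mult_single)
  have gen: "g = (if i = 0 then 1 else gen_e) * ((if j = 0 then 1 else gen_b) * (if k = 0 then 1 else gen_c))"
    using bit_cases[of i] bit_cases[of j] bit_cases[of k]
    by (auto simp: g gen_e_def gen_b_def gen_c_def one_grp_def)
  have "l 1 (act g (Var 1 + Const 2 * Var 3)) = 1" "l 3 (act g (Var 1 + Const 2 * Var 3)) = 2"
    by (simp_all add: assms l_add l_Var l_Const del: single_numeral)
  then show ?thesis
    unfolding gen
    by (auto simp: act_add act_mult act_uminus act_generators l_add l_minus l_Var l_Const simp flip: act_act
        simp del: single_numeral split: if_splits)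
qed

section \<open>The Poisson bracket of the two test invariants\<close>

lemma pdiff_add: "pdiff i (p + q) = pdiff i p + pdiff i q"
  unfolding pdiff_def
  by (rule setsum_keys_plus_distrib) (simp_all add: single_add distrib_left)

lemma pdiff_Var_square: "pdiff i (Var j * Var j) = (if i = j then 2 * Var j else 0)"
proof -
  have "2 * Poly_Mapping.single m 1 = (Poly_Mapping.single m 2 :: cpoly)" for m
    by (simp add: mult_2 flip: single_add)
  then show ?thesis
    by (simp add: Var_def mult_single pdiff_single lookup_add lookup_single)
qed

lemma poisson_example:
  "poisson (Var 1 * Var 1 + Var 3 * Var 3) (Var 2 * Var 2 + Var 4 * Var 4) =
    4 * (Var 1 * Var 2 + Var 3 * Var 4)"
  by (simp add: poisson_def pdiff_add pdiff_Var_square algebra_simps)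


section \<open>The twisted group algebra\<close>

lemma coeff_at_basis_elt: "coeff_at (basis_elt p g) h = (if h = g then p else 0)"
  by (simp add: basis_elt_def Twisted_inverse)

lemma twisted_eqI: "(\<And>g. coeff_at a g = coeff_at b g) \<Longrightarrow> a = b"
  by (simp add: coeff_at_inject[symmetric] fun_eq_iff)

lemma coeff_at_mult: "coeff_at (a * b) k = (\<Sum>g\<in>UNIV. coeff_at a g * act g (coeff_at b (inverse g * k)))"
  by transfer (simp add: twisted_mult_sum)

lemma coeff_at_basis_elt_mult: "coeff_at (basis_elt p g * a) k = p * act g (coeff_at a (inverse g * k))"
proof -
  have "coeff_at (basis_elt p g * a) k =
      (\<Sum>f\<in>UNIV. if f = g then p * act g (coeff_at a (inverse g * k)) else 0)"
    unfolding coeff_at_mult by (rule sum.cong) (auto simp: coeff_at_basis_elt)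
  then show ?thesis by simp
qed

lemma coeff_at_mult_basis_elt:
  "coeff_at (a * basis_elt p g) k = coeff_at a (k * inverse g) * act (k * inverse g) p"
proof -
  have "inverse f * k = g \<longleftrightarrow> f = k * inverse g" for f
    by (metis grp_inverse(1) grp_inverse_mult_eq_iff mult.assoc mult_1_right grp_inverse(2))
  then have "coeff_at (a * basis_elt p g) k =
      (\<Sum>f\<in>UNIV. if f = k * inverse g then coeff_at a (k * inverse g) * act (k * inverse g) p else 0)"
    unfolding coeff_at_mult by (intro sum.cong) (auto simp: coeff_at_basis_elt)
  then show ?thesis by simp
qed

lemma embed_poly_invariant_central:
  assumes "p \<in> invariants"
  shows "embed_poly p * a = a * embed_poly p"
  using assms
  by (intro twisted_eqI)
    (simp add: embed_poly_def coeff_at_basis_elt_mult coeff_at_mult_basis_elt invariants_def mult.commute)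

lemma central_obtain_invariant:
  assumes z: "\<And>a. z * a = a * z"
  obtains p where "p \<in> invariants" "z = embed_poly p"
proof
  \<comment> \<open>Commuting with this polynomial confines \<open>z\<close> to its coefficient at
    1, since the polynomial ring has no zero divisors.\<close>
  let ?v = "Var 1 + Const 2 * Var 3"
  have zero: "coeff_at z g = 0" if "g \<noteq> 1" for g
  proof -
    have "coeff_at (z * embed_poly ?v) g = coeff_at (embed_poly ?v * z) g"
      by (simp only: z)
    then have "coeff_at z g * (act g ?v - ?v) = 0"
      unfolding embed_poly_def coeff_at_basis_elt_mult coeff_at_mult_basis_elt
      by (simp add: right_diff_distrib mult.commute)
    moreover have "act g ?v - ?v \<noteq> 0"
      using act_Var13_eq_imp that by auto
    ultimately show ?thesis by (metis mult_eq_0_iff)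
  qed
  show "z = embed_poly (coeff_at z 1)"
    by (rule twisted_eqI) (simp add: embed_poly_def coeff_at_basis_elt zero)
  \<comment> \<open>Invariance comes from commuting with the group element \<open>g\<close>
    itself.\<close>
  have "act g (coeff_at z 1) = coeff_at z 1" for g
    using arg_cong[OF z[of "basis_elt 1 g"], of "\<lambda>a. coeff_at a g"]
    by (simp add: coeff_at_basis_elt_mult coeff_at_mult_basis_elt act_one)
  then show "coeff_at z 1 \<in> invariants" by (simp add: invariants_def)
qed

text \<open>
  The \<open>s\<close>-coefficient of \<open>k a k\<^sup>-\<^sup>1\<close>, summed over \<open>k\<close>. It is a trace when \<open>r\<close> factors through the
  restriction to \<open>V\<^sup>s\<close>.
\<close>

definition class_trace :: "grp \<Rightarrow> (cpoly \<Rightarrow> cpoly) \<Rightarrow> twisted \<Rightarrow> cpoly" where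
  "class_trace s r a = (\<Sum>k\<in>UNIV. r (act k (coeff_at a (inverse k * s * k))))"

locale class_trace_hom =
  fixes s :: grp and r :: "cpoly \<Rightarrow> cpoly"
  assumes r_add: "r (p + q) = r p + r q"
    and r_mult: "r (p * q) = r p * r q"
    and r_act: "r (act s p) = r p"
begin

lemma r_0 [simp]: "r 0 = 0"
  using r_add[of 0 0] by simp

lemma r_sum: "r (sum f A) = (\<Sum>i\<in>A. r (f i))"
  by (induction A rule: infinite_finite_induct) (simp_all add: r_add)

lemma class_trace_0: "class_trace s r 0 = 0"
  by (simp add: class_trace_def zero_twisted.rep_eq)

lemma class_trace_add: "class_trace s r (a + b) = class_trace s r a + class_trace s r b"
  by (simp add: class_trace_def plus_twisted.rep_eq act_add r_add sum.distrib)

lemma class_trace_scaleC: "class_trace s r (c *\<^sub>C a) = r (Const c) * class_trace s r a"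
  by (simp add: class_trace_def scaleC_twisted.rep_eq act_mult r_mult sum_distrib_left)

lemma class_trace_diff: "class_trace s r (a - b) = class_trace s r a - class_trace s r b"
  using class_trace_add[of "a - b" b] by simp

text \<open>If \<open>h * g = inverse k * s * k\<close>, then
  \<open>g * h = inverse (k * h) * s * (k * h)\<close>, so replacing \<open>k\<close> by
  \<open>k * h\<close> matches the terms. One group element then becomes \<open>s * k\<close>, and
  \<open>r_act\<close> removes the \<open>s\<close>.\<close>

lemma class_trace_mult_commute: "class_trace s r (a * b) = class_trace s r (b * a)"
proof -
  let ?F = "\<lambda>a b (k, g). r (act k (coeff_at a g)) * r (act (k * g) (coeff_at b (inverse g * (inverse k * s * k))))"
  have expand: "class_trace s r (a * b) = sum (?F a b) (UNIV \<times> UNIV)" for a b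
    by (simp add: class_trace_def coeff_at_mult act_sum r_sum act_mult r_mult act_act
        sum.cartesian_product)
  have r_act': "r (act (s * k) p) = r (act k p)" for k p
    by (metis act_act r_act)
  have move: "inverse (inverse h * (inverse k * (s * k))) * (inverse (k * h) * (s * (k * h))) = h" for h k
    by (simp add: grp_inverse_mult grp_inverse_inverse mult.assoc)
  let ?i = "\<lambda>(k, h). (k * h, inverse h * (inverse k * s * k))"
  have "sum (?F b a) (UNIV \<times> UNIV) = sum (?F a b) (UNIV \<times> UNIV)"
  proof (rule sum.reindex_bij_witness[of _ "\<lambda>(k, g). (inverse s * k * g, inverse g * (inverse k * s * k))" ?i])
    fix x :: "grp \<times> grp"
    obtain k h where x: "x = (k, h)" by (cases x)
    show "(case ?i x of (k, g) \<Rightarrow> (inverse s * k * g, inverse g * (inverse k * s * k))) = x"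
      using move[of h k] by (simp add: x mult.assoc)
    have "k * h * (inverse h * (inverse k * (s * k))) = s * k"
      by (simp add: mult.assoc)
    then show "?F a b (?i x) = ?F b a x"
      by (simp only: x split mult.assoc[of "_ :: grp"] move r_act' mult.commute[of "r (act k _)"])
    show "?i (case x of (k, g) \<Rightarrow> (inverse s * k * g, inverse g * (inverse k * s * k))) = x"
      by (simp add: x mult.assoc grp_inverse_mult grp_inverse_inverse)
  qed auto
  then show ?thesis by (simp only: expand)
qed

lemma class_trace_proj_eq:
  assumes "proj a = proj b"
  shows "class_trace s r a = class_trace s r b"
proof -
  have "a - b \<in> complex_vec.span {a * b - b * a | a b. True}"
    using assms by (simp add: proj_eq_iff commutator_space_def)
  then have "class_trace s r (a - b) = 0"
  proof (induction rule: complex_vec.span_induct_alt)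
    case base
    show ?case by (rule class_trace_0)
  next
    case (step c x y)
    then show ?case
      by (auto simp: class_trace_add class_trace_scaleC class_trace_diff class_trace_mult_commute)
  qed
  then show ?thesis by (simp add: class_trace_diff)
qed

end

text \<open>The trace for \<open>s = 1\<close> and the identity map sums the translates of the
  coefficient at 1. It multiplies an invariant by the group order, which is nonzero in
  characteristic zero.\<close>

lemma proj_embed_poly_inject:
  assumes "p \<in> invariants" "q \<in> invariants" and eq: "proj (embed_poly p) = proj (embed_poly q)"
  shows "p = q"
proof -
  interpret class_trace_hom 1 "\<lambda>p. p" by unfold_locales simp_all
  have tr: "class_trace 1 (\<lambda>p. p) (embed_poly p) = of_nat CARD(grp) * p" if "p \<in> invariants" for p
    using that by (simp add: class_trace_def embed_poly_def coeff_at_basis_elt invariants_def)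
  have "of_nat CARD(grp) * p = of_nat CARD(grp) * q"
    using class_trace_proj_eq[OF eq] assms(1,2) by (simp only: tr)
  moreover have "(of_nat CARD(grp) :: cpoly) \<noteq> 0"
    by (metis of_nat_eq_0_iff zero_less_card_finite less_irrefl)
  ultimately show ?thesis by (metis mult_left_cancel)
qed

text \<open>Evaluation at the point \<open>(0, 0, 1, 1)\<close> of \<open>V\<^sup>b\<close>.\<close>

definition point_eval :: "cpoly \<Rightarrow> cpoly" where
  "point_eval = poly_subst (\<lambda>i. if i = 3 \<or> i = 4 then 1 else 0)"

text \<open>The coordinates whose sign \<open>gen_b\<close> changes are zero at the chosen
  point.\<close>

lemma class_trace_hom_point_eval: "class_trace_hom gen_b point_eval"
proof
  let ?s = "\<lambda>i::4. if i = 3 \<or> i = 4 then 1 else (0::cpoly)"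
  show "point_eval (p + q) = point_eval p + point_eval q" for p q
    by (simp add: point_eval_def poly_subst_add)
  show "point_eval (p * q) = point_eval p * point_eval q" for p q
    by (simp add: point_eval_def poly_subst_mult)
  have "poly_subst ?s (\<Sum>j\<in>UNIV. Const (mat_b $ i $ j) * Var j) = ?s i" for i
    using exhaust_4[of i]
    by (auto simp: sum_4 mat_b_def vector_4 poly_subst_add poly_subst_mult)
  then show "point_eval (act gen_b p) = point_eval p" for p
    by (simp add: point_eval_def act_def pullback_def poly_subst_subst gen_b_def)
qed

interpretation trace_b: class_trace_hom gen_b point_eval
  by (rule class_trace_hom_point_eval)

text \<open>The identity is not conjugate to \<open>gen_b\<close>.\<close>

lemma trace_b_embed_poly: "class_trace gen_b point_eval (embed_poly p) = 0"
proof -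
  have "inverse k * gen_b * k \<noteq> 1" for k
  proof
    assume "inverse k * gen_b * k = 1"
    then have "k * inverse k * gen_b * (k * inverse k) = k * 1 * inverse k"
      by (metis mult.assoc)
    then have "gen_b = 1" by simp
    then show False by (simp add: gen_b_def one_grp_def)
  qed
  then show ?thesis
    by (simp add: class_trace_def embed_poly_def coeff_at_basis_elt)
qed

text \<open>The trace is the value of \<open>p\<close> at the chosen point times the order of the
  centralizer \<open>?C\<close>, which is nonzero.\<close>

lemma trace_b_basis_elt_eq_0:
  assumes "p \<in> invariants" "class_trace gen_b point_eval (basis_elt p gen_b) = 0"
  shows "point_eval p = 0"
proof -
  let ?C = "{k. inverse k * gen_b * k = gen_b}"
  have "class_trace gen_b point_eval (basis_elt p gen_b) = (\<Sum>k\<in>UNIV. if k \<in> ?C then point_eval p else 0)"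
    using assms(1) unfolding class_trace_def
    by (intro sum.cong) (auto simp: coeff_at_basis_elt invariants_def)
  also have "\<dots> = of_nat (card ?C) * point_eval p"
    by (simp add: sum.If_cases)
  finally have "of_nat (card ?C) * point_eval p = 0"
    using assms(2) by simp
  then have "(of_nat (card ?C) :: cpoly) = 0 \<or> point_eval p = 0"
    by (simp only: mult_eq_0_iff)
  moreover have "1 \<in> ?C" by simp
  then have "card ?C \<noteq> 0" by (metis card_eq_0_iff empty_iff finite)
  then have "(of_nat (card ?C) :: cpoly) \<noteq> 0" by (simp only: of_nat_eq_0_iff not_False_eq_True)
  ultimately show ?thesis by blast
qed

theorem proposition2:
  shows "\<not> (\<exists>br :: twisted comm_quotient \<Rightarrow> twisted comm_quotient \<Rightarrow> twisted comm_quotient.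
    nc_poisson_structure br \<and>
    (\<forall>\<phi>\<in>invariants. \<forall>\<psi>\<in>invariants.
       br (proj (embed_poly \<phi>)) (proj (embed_poly \<psi>)) = proj (embed_poly (poisson \<phi> \<psi>))))"
proof
  assume "\<exists>br :: twisted comm_quotient \<Rightarrow> twisted comm_quotient \<Rightarrow> twisted comm_quotient.
    nc_poisson_structure br \<and>
    (\<forall>\<phi>\<in>invariants. \<forall>\<psi>\<in>invariants.
       br (proj (embed_poly \<phi>)) (proj (embed_poly \<psi>)) = proj (embed_poly (poisson \<phi> \<psi>)))"
  then obtain br :: "twisted comm_quotient \<Rightarrow> twisted comm_quotient \<Rightarrow> twisted comm_quotient"
    where br: "lie_bracket br"
      and der: "\<And>a. \<exists>d. derivation d \<and> (\<forall>b. br (proj a) (proj b) = proj (d b))"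
      and ext: "\<And>\<phi> \<psi>. \<phi> \<in> invariants \<Longrightarrow> \<psi> \<in> invariants \<Longrightarrow>
        br (proj (embed_poly \<phi>)) (proj (embed_poly \<psi>)) = proj (embed_poly (poisson \<phi> \<psi>))"
    unfolding nc_poisson_structure_def by blast
  define \<phi> \<psi> \<theta> :: cpoly
    where "\<phi> = Var 1 * Var 1 + Var 3 * Var 3" and "\<psi> = Var 2 * Var 2 + Var 4 * Var 4"
      and "\<theta> = poisson \<phi> \<psi>"
  have \<theta>: "\<theta> = Const 4 * (Var 1 * Var 2 + Var 3 * Var 4)"
    by (simp add: \<theta>_def \<phi>_def \<psi>_def poisson_example)
  have inv: "\<phi> \<in> invariants" "\<psi> \<in> invariants" "\<theta> \<in> invariants"
    unfolding \<theta> \<phi>_def \<psi>_def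
    by (intro invariantsI; simp add: act_add act_mult act_generators add.commute del: single_numeral)+
  let ?b = "basis_elt 1 gen_b"
  have b: "?b * ?b = 1"
    by (rule twisted_eqI)
      (simp add: basis_elt_mult act_one grp_relations coeff_at_basis_elt one_twisted.rep_eq)
  have times_b: "embed_poly p * ?b = basis_elt p gen_b" for p
    by (simp add: embed_poly_def basis_elt_mult)

  obtain d where d: "derivation d" and br_\<phi>: "\<And>a. br (proj (embed_poly \<phi>)) (proj a) = proj (d a)"
    using der by blast
  obtain p where p: "p \<in> invariants" "d (embed_poly \<psi>) = embed_poly p"
    using central_obtain_invariant derivation_central[OF d embed_poly_invariant_central[OF inv(2)]]
    by metis
  have "proj (embed_poly p) = proj (embed_poly \<theta>)"
    using br_\<phi>[of "embed_poly \<psi>"] ext[OF inv(1,2)] by (simp add: p(2) \<theta>_def)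
  \<comment> \<open>Injectivity on invariants lifts the equality of classes to one in the
    algebra.\<close>
  then have "d (embed_poly \<psi>) = embed_poly \<theta>"
    using proj_embed_poly_inject p inv(3) by metis
  then have "d (basis_elt \<psi> gen_b) = basis_elt \<theta> gen_b + embed_poly \<psi> * d ?b"
    using derivation_mult[OF d, of "embed_poly \<psi>" ?b] by (simp only: times_b)
  then have "br (proj (embed_poly \<phi>)) (proj (basis_elt \<psi> gen_b)) =
      proj (basis_elt \<theta> gen_b) + proj (embed_poly \<psi> * d ?b)"
    by (simp only: br_\<phi> proj_add)
  also have "proj (embed_poly \<psi> * d ?b) = 0"
    by (rule proj_derivation_involution[OF d embed_poly_invariant_central[OF inv(2)] b])
  finally have 1: "br (proj (embed_poly \<phi>)) (proj (basis_elt \<psi> gen_b)) = proj (basis_elt \<theta> gen_b)"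
    by simp

  \<comment> \<open>The same bracket with its arguments exchanged: the central argument is now the
    one differentiated.\<close>
  obtain d' where d': "derivation d'"
    and br_\<psi>b: "\<And>a. br (proj (basis_elt \<psi> gen_b)) (proj a) = proj (d' a)"
    using der by blast
  obtain q where q: "d' (embed_poly \<phi>) = embed_poly q"
    using central_obtain_invariant derivation_central[OF d' embed_poly_invariant_central[OF inv(1)]]
    by metis
  have "proj (basis_elt \<theta> gen_b) = - proj (embed_poly q)"
    using 1 br_\<psi>b[of "embed_poly \<phi>"] lie_bracket_skew[OF br] q by metis
  then have "proj (basis_elt \<theta> gen_b + embed_poly q) = proj 0"
    by (simp add: proj_add proj_0)
  then have "class_trace gen_b point_eval (basis_elt \<theta> gen_b + embed_poly q) = class_trace gen_b point_eval 0"
    by (rule trace_b.class_trace_proj_eq)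
  then have "class_trace gen_b point_eval (basis_elt \<theta> gen_b) = 0"
    by (simp add: trace_b.class_trace_add trace_b_embed_poly trace_b.class_trace_0)
  then have "point_eval \<theta> = 0"
    by (rule trace_b_basis_elt_eq_0[OF inv(3)])
  moreover have "point_eval \<theta> = Const 4"
    unfolding \<theta> point_eval_def
    by (simp add: poly_subst_mult poly_subst_add del: single_numeral)
  ultimately show False by simp
qed

end
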